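(* Let $A$ be an idiom and $d$ any inflator on $A$. Then the interval $[u_{d(\underline{0})},\iota_{d(\underline{0})}]$ of $I(A)$ is collapsed by taking totalizers, i.e. $t(k)=t(k')$ for all $k,k'\in[u_{d(\underline{0})},\iota_{d(\underline{0})}]$. Moreover, the intervals of the form $[u_{d(\underline{0})},\iota_{d(\underline{0})}]$ ($d\in I(A)$) are exactly the blocks of the partition of $I(A)$ given by $\sim_t$, and there is a bijection between $\mathrm{Tot}(I(A))$ and the set of intervals of the form $[u_{d(\underline{0})},\iota_{d(\underline{0})}]$.
   Context: An idiom is a complete modular lattice $A$ with top $\bar{1}$ and bottom $\underline{0}$ that is meet-continuous: $a\wedge\bigvee X=\bigvee\{a\wedge x\mid x\in X\}$ for all $a\in A$ and all directed $X\subseteq A$. An inflator on $A$ is a monotone map $d\colon A\to A$ with $a\le d(a)$ for all $a\in A$. $I(A)$ is the set of all inflators, ordered pointwise; it is a complete lattice whose infima are computed pointwise, with top $\bar{d}$, where $\bar{d}(a)=\bar{1}$ for all $a$. The product of inflators is composition: $(zd)(a)=z(d(a))$. The totalizer of $d\in I(A)$ is $t(d)=\bigwedge\{z\in I(A)\mid zd=\bar{d}\}$. For $b\in A$, the inflator $O_b$ is defined by $O_b(a)=\bar{1}$ if $a\ge b$, and $O_b(a)=a$ otherwise. $\mathrm{Tot}(I(A))$ is the set of all totalizers, i.e. of all inflators $O_{d(\underline{0})}$, $d\in I(A)$ (one has $t(d)=O_{d(\underline{0})}$). The equivalence relation $\sim_t$ on $I(A)$ is: $d\sim_t d'$ if and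 only if $t(d)=t(d')$. For $a\in A$, the inflators $u_a$ and $\iota_a$ on $A$ are defined by $u_a(b)=a\vee b$; $\iota_a(\underline{0})=a$ and $\iota_a(b)=\bar{1}$ for $b\ne\underline{0}$. *)

theory Defs
  imports Main
begin

definition (in order) updirected :: "'a set \<Rightarrow> bool" where
  "updirected X \<longleftrightarrow> X \<noteq> {} \<and> (\<forall>x\<in>X. \<forall>y\<in>X. \<exists>z\<in>X. x \<le> z \<and> y \<le> z)"

class idiom = complete_lattice +
  assumes modular: "a \<le> b \<Longrightarrow> inf (sup a c) b = sup a (inf c b)"
    and meet_continuous: "updirected X \<Longrightarrow> inf a (Sup X) = Sup (inf a ` X)"

(* I(A), as a subset of the function type, whose library order is pointwise. *)
definition inflators :: "('a::idiom \<Rightarrow> 'a) set" where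
  "inflators = {d. mono d \<and> (\<forall>a. a \<le> d a)}"

(* Infima in I(A) coincide with those of the complete lattice of all functions:
   these are pointwise, and I(A) is closed under them, including the empty infimum
   top, which is the constant function with value top. *)
lemma Inf_inflators: "Z \<subseteq> inflators \<Longrightarrow> Inf Z \<in> inflators"
proof -
  assume Z: "Z \<subseteq> inflators"
  have "mono (Inf Z)"
  proof (rule monoI)
    fix a b :: 'a
    assume ab: "a \<le> b"
    show "Inf Z a \<le> Inf Z b"
      unfolding Inf_apply
    proof (rule INF_mono)
      fix z assume z: "z \<in> Z"
      then have "mono z" using Z by (auto simp: inflators_def)
      then have "z a \<le> z b" using ab by (rule monoD)
      with z show "\<exists>y\<in>Z. y a \<le> z b" by blast
    qed
  qed
  moreover have "a \<le> Inf Z a" for a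
    unfolding Inf_apply using Z by (intro INF_greatest) (auto simp: inflators_def)
  ultimately show ?thesis by (simp add: inflators_def)
qed

definition totalizer :: "('a::idiom \<Rightarrow> 'a) \<Rightarrow> 'a \<Rightarrow> 'a" where
  "totalizer d = Inf {z \<in> inflators. z \<circ> d = top}"

definition Tot :: "('a::idiom \<Rightarrow> 'a) set" where
  "Tot = totalizer ` inflators"

definition tot_rel :: "(('a::idiom \<Rightarrow> 'a) \<times> ('a \<Rightarrow> 'a)) set" where
  "tot_rel = {(d, d'). d \<in> inflators \<and> d' \<in> inflators \<and> totalizer d = totalizer d'}"

lemma equiv_tot_rel: "equiv inflators tot_rel"
  by (rule equivI) (auto simp: tot_rel_def refl_on_def sym_def trans_def)

definition u :: "'a::idiom \<Rightarrow> 'a \<Rightarrow> 'a" where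
  "u a b = sup a b"

definition iota :: "'a::idiom \<Rightarrow> 'a \<Rightarrow> 'a" where
  "iota a b = (if b = bot then a else top)"

lemma u_inflator: "u a \<in> inflators"
  by (auto simp: inflators_def u_def mono_def intro: le_supI2)

lemma iota_inflator: "iota a \<in> inflators"
  by (auto simp: inflators_def iota_def mono_def bot_unique)

definition infl_interval :: "('a::idiom \<Rightarrow> 'a) \<Rightarrow> ('a \<Rightarrow> 'a) \<Rightarrow> ('a \<Rightarrow> 'a) set" where
  "infl_interval f g = {k \<in> inflators. f \<le> k \<and> k \<le> g}"

definition bot_interval :: "('a::idiom \<Rightarrow> 'a) \<Rightarrow> ('a \<Rightarrow> 'a) set" where
  "bot_interval d = infl_interval (u (d bot)) (iota (d bot))"

end

theory Submission
  imports Defs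
begin

text \<open>
  Everything about an inflator \<open>d\<close> that matters here is the single element \<open>d bot\<close>.
  By monotonicity \<open>d bot\<close> is the least value of \<open>d\<close>, so \<open>z \<circ> d\<close> is constantly \<open>top\<close>
  as soon as \<open>z (d bot) = top\<close>, and the least inflator with this property is the one that sends
  the up-set of \<open>d bot\<close> to \<open>top\<close> and fixes all other elements (\<open>totalizer_eq_up_collapse\<close>).
  Since an up-set determines its generator, two inflators have the same totalizer iff they agree
  at \<open>bot\<close> (\<open>totalizer_eq_iff\<close>). On the other hand, \<open>u a\<close> and \<open>iota a\<close> are the least and the
  greatest inflators with value \<open>a\<close> at \<open>bot\<close>, so the interval between them also consists of the
  inflators with that value (\<open>bot_interval_eq\<close>). Hence the intervals are the fibres of
  \<open>totalizer\<close>, that is, the blocks of its kernel, and the blocks of the kernel of a map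
  correspond to the elements of its image.
\<close>

text \<open>This is the inflator \<open>O\<^sub>b\<close>.\<close>
definition up_collapse :: "'a::idiom \<Rightarrow> 'a \<Rightarrow> 'a" where
  "up_collapse b a = (if b \<le> a then top else a)"

lemma up_collapse_inflator: "up_collapse b \<in> inflators"
  by (auto simp: inflators_def up_collapse_def mono_def dest: order_trans)

lemma up_collapse_eq_top_iff: "up_collapse b a = top \<longleftrightarrow> b \<le> a"
  by (auto simp: up_collapse_def)

lemma up_collapse_inject: "up_collapse b = up_collapse c \<longleftrightarrow> b = c"
proof
  assume "up_collapse b = up_collapse c"
  then have "b \<le> a \<longleftrightarrow> c \<le> a" for a
    by (simp flip: up_collapse_eq_top_iff)
  then show "b = c" by (blast intro: order_antisym)
qed simp

lemma comp_eq_top_iff: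
  assumes "z \<in> inflators" "d \<in> inflators"
  shows "z \<circ> d = top \<longleftrightarrow> z (d bot) = top"
proof
  assume "z \<circ> d = top"
  then have "(z \<circ> d) bot = top" by simp
  then show "z (d bot) = top" by simp
next
  assume z: "z (d bot) = top"
  have "z (d bot) \<le> z (d a)" for a
    using assms by (auto simp: inflators_def intro!: monoD[of z] monoD[of d])
  then show "z \<circ> d = top" using z by (simp add: fun_eq_iff top_unique)
qed

text \<open>
  An inflator \<open>z\<close> with \<open>z (d bot) = top\<close> must be \<open>top\<close> on the whole up-set of \<open>d bot\<close>, and outside
  it the only lower bound on \<open>z a\<close> is \<open>a\<close>; so the infimum that defines the totalizer is attained.
\<close>
lemma totalizer_eq_up_collapse:
  assumes d: "d \<in> inflators"
  shows "totalizer d = up_collapse (d bot)"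
  unfolding totalizer_def
proof (rule Inf_eqI)
  fix z assume "z \<in> {z \<in> inflators. z \<circ> d = top}"
  then have z: "z \<in> inflators" and top: "z (d bot) = top"
    using d by (auto simp: comp_eq_top_iff)
  show "up_collapse (d bot) \<le> z"
  proof (rule le_funI)
    fix a
    have "z (d bot) \<le> z a" if "d bot \<le> a"
      using z that by (auto simp: inflators_def intro: monoD)
    then have "z a = top" if "d bot \<le> a"
      using that top by (simp add: top_unique)
    moreover have "a \<le> z a" using z by (simp add: inflators_def)
    ultimately show "up_collapse (d bot) a \<le> z a" by (simp add: up_collapse_def)
  qed
next
  fix y assume lower: "\<And>z. z \<in> {z \<in> inflators. z \<circ> d = top} \<Longrightarrow> y \<le> z"
  show "y \<le> up_collapse (d bot)"
    using d by (intro lower) (simp add: up_collapse_inflator comp_eq_top_iff up_collapse_eq_top_iff)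
qed

lemma totalizer_eq_iff:
  assumes "d \<in> inflators" "d' \<in> inflators"
  shows "totalizer d = totalizer d' \<longleftrightarrow> d bot = d' bot"
  using assms by (simp add: totalizer_eq_up_collapse up_collapse_inject)

text \<open>
  Evaluating \<open>u a \<le> k \<le> iota a\<close> at \<open>bot\<close> forces \<open>k bot = a\<close>. Conversely, \<open>k b\<close> lies above \<open>b\<close> because
  \<open>k\<close> is inflationary and above \<open>k bot\<close> because it is monotone, hence above \<open>u (k bot) b\<close>; the
  bound by \<open>iota (k bot)\<close> says something at \<open>bot\<close> only, where it is an equality.
\<close>
lemma infl_interval_u_iota: "infl_interval (u a) (iota a) = {k \<in> inflators. k bot = a}"
proof (intro equalityI subsetI)
  fix k assume k: "k \<in> infl_interval (u a) (iota a)"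
  then have "u a bot \<le> k bot" "k bot \<le> iota a bot"
    by (auto simp: infl_interval_def dest: le_funD)
  then have "k bot = a" by (auto simp: u_def iota_def intro: order_antisym)
  with k show "k \<in> {k \<in> inflators. k bot = a}" by (simp add: infl_interval_def)
next
  fix k assume k: "k \<in> {k \<in> inflators. k bot = a}"
  then have "u a \<le> k" by (auto simp: le_fun_def u_def inflators_def intro: monoD)
  moreover have "k \<le> iota a" using k by (auto simp: le_fun_def iota_def)
  ultimately show "k \<in> infl_interval (u a) (iota a)" using k by (simp add: infl_interval_def)
qed

lemma bot_interval_eq: "bot_interval d = {k \<in> inflators. k bot = d bot}"
  by (simp add: bot_interval_def infl_interval_u_iota)

lemma bot_interval_eq_totalizer_fibre:
  assumes "d \<in> inflators"
  shows "bot_interval d = {k \<in> inflators. totalizer k = totalizer d}"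
  using assms by (auto simp: bot_interval_eq totalizer_eq_iff)

lemma bot_interval_eq_block:
  assumes "d \<in> inflators"
  shows "bot_interval d = tot_rel `` {d}"
  using assms by (auto simp: bot_interval_eq_totalizer_fibre tot_rel_def)

theorem theorem3p8:
  shows "(\<forall>d::'a::idiom \<Rightarrow> 'a. d \<in> inflators \<longrightarrow>
            (\<forall>k \<in> bot_interval d. \<forall>k' \<in> bot_interval d. totalizer k = totalizer k'))
       \<and> bot_interval ` (inflators :: ('a \<Rightarrow> 'a) set) = inflators // tot_rel
       \<and> (\<exists>F. bij_betw F (Tot :: ('a \<Rightarrow> 'a) set) (bot_interval ` (inflators :: ('a \<Rightarrow> 'a) set)))"
proof (intro conjI allI impI ballI)
  fix d k k' :: "'a \<Rightarrow> 'a"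
  assume "d \<in> inflators" "k \<in> bot_interval d" "k' \<in> bot_interval d"
  then show "totalizer k = totalizer k'" by (simp add: bot_interval_eq_totalizer_fibre)
next
  show "bot_interval ` (inflators :: ('a \<Rightarrow> 'a) set) = inflators // tot_rel"
    by (auto simp: quotient_def bot_interval_eq_block)
next
  define fibre :: "('a \<Rightarrow> 'a) \<Rightarrow> ('a \<Rightarrow> 'a) set"
    where "fibre t = {k \<in> inflators. totalizer k = t}" for t
  \<comment> \<open>Fibres over the image of a map are nonempty, hence distinct.\<close>
  have "inj_on fibre Tot" by (rule inj_onI) (auto simp: fibre_def Tot_def)
  moreover have "fibre ` Tot = bot_interval ` inflators"
    unfolding Tot_def image_image
    by (rule image_cong) (simp_all add: fibre_def bot_interval_eq_totalizer_fibre)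
  ultimately have "bij_betw fibre Tot (bot_interval ` inflators)"
    by (rule bij_betw_imageI)
  then show "\<exists>F. bij_betw F (Tot :: ('a \<Rightarrow> 'a) set) (bot_interval ` (inflators :: ('a \<Rightarrow> 'a) set))"
    by (rule exI[of _ fibre])
qed

end
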